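(* Let $s\geq 3$ and $d\geq 5$ be fixed integers with $d\geq s+2$. Then there is a constant $c=c(d)$ such that there exists a $K_s$-free graph on $n$ vertices with VC-dimension at most $d$ and no independent set of size $c\,n^{\frac{2}{s+1}}\log n$.
   Context: For a graph $G=(V,E)$ and $v\in V$, $N(v)$ denotes the set of vertices adjacent to $v$ ($v\notin N(v)$). The VC-dimension of a set system $\mathcal{F}$ on ground set $V$ is the largest $d$ such that some $d$-element $S\subset V$ satisfies: for every $B\subset S$ there is $A\in\mathcal{F}$ with $A\cap S=B$. The VC-dimension of a graph $G$ is the VC-dimension of $\{N(v):v\in V\}$. Logarithms are natural. *)

theory Defs
  imports Complex_Main "HOL-Library.Ramsey" "HOL-Library.Extended_Nat"
begin

text \<open>
  Finite simple graphs are pairs of a vertex set and a set of two-element vertex sets, the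
  representation on which \<^const>\<open>clique\<close> and \<^const>\<open>indep\<close> operate.
\<close>

definition simple_graph :: "'a set \<Rightarrow> 'a set set \<Rightarrow> bool"
  where "simple_graph V E \<longleftrightarrow> finite V \<and> E \<subseteq> [V]\<^bsup>2\<^esup>"

definition neighbourhood :: "'a set set \<Rightarrow> 'a \<Rightarrow> 'a set"
  where "neighbourhood E v = {w. w \<noteq> v \<and> {v, w} \<in> E}"

definition shatters :: "'a set set \<Rightarrow> 'a set \<Rightarrow> bool"
  where "shatters \<F> S \<longleftrightarrow> (\<forall>B\<subseteq>S. \<exists>A\<in>\<F>. A \<inter> S = B)"

text \<open>
  The supremum in \<^typ>\<open>enat\<close> makes the VC-dimension infinite when there are arbitrarily large
  shattered sets; on a finite ground set it is attained, provided the set system is nonempty.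
\<close>

definition vc_dim :: "'a set \<Rightarrow> 'a set set \<Rightarrow> enat"
  where "vc_dim V \<F> = (SUP S\<in>{S. S \<subseteq> V \<and> finite S \<and> shatters \<F> S}. enat (card S))"

lemma vc_dim_attained:
  assumes "finite V" "\<F> \<noteq> {}"
  shows "\<exists>S\<subseteq>V. shatters \<F> S \<and> vc_dim V \<F> = enat (card S)"
proof -
  define X where "X = {S. S \<subseteq> V \<and> finite S \<and> shatters \<F> S}"
  have fin: "finite ((\<lambda>S. enat (card S)) ` X)"
    using assms(1) by (simp add: X_def)
  have "{} \<in> X"
    using assms(2) by (auto simp: X_def shatters_def)
  then have ne: "(\<lambda>S. enat (card S)) ` X \<noteq> {}"
    by blast
  have "vc_dim V \<F> = Max ((\<lambda>S. enat (card S)) ` X)"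
    using Max_Sup[OF fin ne] by (simp add: vc_dim_def X_def)
  with Max_in[OF fin ne] show ?thesis
    by (auto simp: X_def)
qed

definition graph_vc_dim :: "'a set \<Rightarrow> 'a set set \<Rightarrow> enat"
  where "graph_vc_dim V E = vc_dim V (neighbourhood E ` V)"

definition K_free :: "nat \<Rightarrow> 'a set \<Rightarrow> 'a set set \<Rightarrow> bool"
  where "K_free s V E \<longleftrightarrow> \<not> (\<exists>K\<subseteq>V. card K = s \<and> clique K E)"

end

theory Submission
  imports Defs
begin

text \<open>
  Krivelevich's deletion argument. Take a random graph of edge density
  $p = \delta n^{-2/(s+1)}$ and delete the edges of a maximal family of edge-disjoint bad
  subgraphs. Bad are the copies of $K_s$ and, with $k = d + 1$, the sets of $k(k-2)$ edges within
  $2k$ vertices: a shattered $k$-set $S$ forces the latter, because at least $k$ of the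
  $\binom{k}{2} \ge 2k$ vertices that cut out the $(k-2)$-subsets of $S$ lie outside $S$.
  Both kinds of bad subgraph have $v$ vertices and $e$ edges with $v - 2 \le \frac{2}{s+1}(e-1)$, so
  that for small $\delta$ the expected number of bad subgraphs with an edge inside a given vertex set
  is a small fraction of the expected number of edges inside it. A set of
  $t \approx 32 p^{-1} \log n$ vertices then loses all its edges with probability less than $n^{-t}$.
\<close>

section \<open>Random subsets of a finite set\<close>

text \<open>For \<open>E\<close> inside \<open>\<Omega>\<close> this is the probability that a
  random subset, containing each element of \<open>\<Omega>\<close> independently with probability
  p, equals \<open>E\<close>. Probabilities and expectations become finite weighted sums.\<close>

definition bernoulli_weight :: "real \<Rightarrow> 'a set \<Rightarrow> 'a set \<Rightarrow> real"
  where "bernoulli_weight p \<Omega> E = p ^ card E * (1 - p) ^ card (\<Omega> - E)"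

text \<open>The union bound, when \<open>f\<close> is a probability weight.\<close>

lemma sum_UNION_le:
  fixes f :: "'a \<Rightarrow> real"
  assumes "finite I" "\<And>i. i \<in> I \<Longrightarrow> finite (A i)"
    and nonneg: "\<And>i x. i \<in> I \<Longrightarrow> x \<in> A i \<Longrightarrow> 0 \<le> f x"
  shows "sum f (\<Union>i\<in>I. A i) \<le> (\<Sum>i\<in>I. sum f (A i))"
  using assms
proof (induction I)
  case (insert i I)
  have "sum f (\<Union>i\<in>insert i I. A i) \<le> sum f (A i) + sum f (\<Union>i\<in>I. A i)"
    using insert.hyps insert.prems by (simp add: sum_Un) (auto intro!: sum_nonneg)
  also have "sum f (\<Union>i\<in>I. A i) \<le> (\<Sum>i\<in>I. sum f (A i))"
    using insert.IH insert.prems by blast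
  finally show ?case
    using insert.hyps by simp
qed simp

lemma bernoulli_weight_nonneg:
  "0 \<le> p \<Longrightarrow> p \<le> 1 \<Longrightarrow> 0 \<le> bernoulli_weight p \<Omega> E"
  by (simp add: bernoulli_weight_def)

text \<open>Independence: each element contributes \<open>f e\<close> if present and
  \<open>g e\<close> if absent, and the expectation of the product factors. Total mass, containment
  and the exponential moment below are choices of \<open>f\<close> and \<open>g\<close>.\<close>

lemma bernoulli_weight_sum_prod:
  assumes "finite \<Omega>"
  shows "(\<Sum>E\<in>Pow \<Omega>. bernoulli_weight p \<Omega> E * ((\<Prod>e\<in>E. f e) * (\<Prod>e\<in>\<Omega> - E. g e))) =
    (\<Prod>e\<in>\<Omega>. p * f e + (1 - p) * g e)"
  unfolding prod_add[OF assms]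
  by (rule sum.cong) (simp_all add: bernoulli_weight_def prod.distrib)

lemma bernoulli_weight_sum:
  assumes "finite \<Omega>"
  shows "(\<Sum>E\<in>Pow \<Omega>. bernoulli_weight p \<Omega> E) = 1"
  using bernoulli_weight_sum_prod[OF assms, of p "\<lambda>_. 1" "\<lambda>_. 1"] by simp

lemma bernoulli_weight_superset:
  assumes fin: "finite \<Omega>" and "H \<subseteq> \<Omega>"
  shows "(\<Sum>E | E \<subseteq> \<Omega> \<and> H \<subseteq> E. bernoulli_weight p \<Omega> E) = p ^ card H"
proof -
  \<comment> \<open>A zero factor for each missing element of \<open>H\<close> turns the product
    over the complement into the indicator of \<open>H \<subseteq> E\<close>.\<close>
  define g :: "'a \<Rightarrow> real" where "g e = (if e \<in> H then 0 else 1)" for e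
  have g: "(\<Prod>e\<in>\<Omega> - E. g e) = (if H \<subseteq> E then 1 else 0)" if "E \<subseteq> \<Omega>" for E
  proof (cases "H \<subseteq> E")
    case True
    then show ?thesis by (auto simp: g_def intro!: prod.neutral)
  next
    case False
    with assms show ?thesis by (auto simp: g_def)
  qed
  have "(\<Sum>E | E \<subseteq> \<Omega> \<and> H \<subseteq> E. bernoulli_weight p \<Omega> E) =
      (\<Sum>E\<in>Pow \<Omega>. bernoulli_weight p \<Omega> E * ((\<Prod>e\<in>E. 1) * (\<Prod>e\<in>\<Omega> - E. g e)))"
    using fin by (intro sum.mono_neutral_cong_left) (auto simp: g)
  also have "\<dots> = (\<Prod>e\<in>\<Omega>. p * 1 + (1 - p) * g e)"
    by (rule bernoulli_weight_sum_prod[OF fin])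
  also have "\<dots> = (\<Prod>e\<in>H. p)"
    using assms by (intro prod.mono_neutral_cong_right) (auto simp: g_def)
  finally show ?thesis by simp
qed

section \<open>Tail bounds for a fixed target set\<close>

text \<open>Chernoff's method with the exponential moment at -1; the threshold is a quarter of the
  mean of \<open>card (E \<inter> D)\<close>.\<close>

lemma bernoulli_weight_lower_tail:
  assumes fin: "finite \<Omega>" and D: "D \<subseteq> \<Omega>" and p: "0 \<le> p" "p \<le> 1"
  shows "(\<Sum>E | E \<subseteq> \<Omega> \<and> real (card (E \<inter> D)) \<le> real (card D) * p / 4. bernoulli_weight p \<Omega> E)
    \<le> exp (- (real (card D) * p / 4))"
proof -
  define a where "a = real (card D) * p / 4"
  define f :: "'a \<Rightarrow> real" where "f e = (if e \<in> D then exp (- 1) else 1)" for e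
  have finE: "finite E" if "E \<subseteq> \<Omega>" for E
    using that fin by (rule finite_subset)
  have prod_f: "(\<Prod>e\<in>E. f e) = exp (- real (card (E \<inter> D)))" if "E \<subseteq> \<Omega>" for E
  proof -
    have "(\<Prod>e\<in>E. f e) = (\<Prod>e\<in>E \<inter> D. exp (- 1))"
      using finE[OF that] by (intro prod.mono_neutral_cong_right) (auto simp: f_def)
    then show ?thesis by (simp add: exp_of_nat_mult[symmetric])
  qed
  \<comment> \<open>Markov's inequality: on this event
    \<open>exp a * exp (- card (E \<inter> D))\<close> is at least 1.\<close>
  have "(\<Sum>E | E \<subseteq> \<Omega> \<and> real (card (E \<inter> D)) \<le> a. bernoulli_weight p \<Omega> E)
      \<le> (\<Sum>E | E \<subseteq> \<Omega> \<and> real (card (E \<inter> D)) \<le> a.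
            exp a * (bernoulli_weight p \<Omega> E * (\<Prod>e\<in>E. f e)))"
  proof (rule sum_mono)
    fix E assume E: "E \<in> {E. E \<subseteq> \<Omega> \<and> real (card (E \<inter> D)) \<le> a}"
    then have "1 \<le> exp a * (\<Prod>e\<in>E. f e)"
      by (simp add: prod_f exp_add[symmetric])
    then have "bernoulli_weight p \<Omega> E * 1 \<le> bernoulli_weight p \<Omega> E * (exp a * (\<Prod>e\<in>E. f e))"
      by (intro mult_left_mono bernoulli_weight_nonneg p)
    then show "bernoulli_weight p \<Omega> E \<le> exp a * (bernoulli_weight p \<Omega> E * (\<Prod>e\<in>E. f e))"
      by (simp add: mult_ac)
  qed
  also have "\<dots> \<le> (\<Sum>E\<in>Pow \<Omega>. exp a * (bernoulli_weight p \<Omega> E * (\<Prod>e\<in>E. f e)))"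
    using fin by (intro sum_mono2) (auto simp: prod_f bernoulli_weight_nonneg[OF p])
  also have "\<dots> = exp a * (\<Prod>e\<in>\<Omega>. p * f e + (1 - p))"
    using bernoulli_weight_sum_prod[OF fin, of p f "\<lambda>_. 1"] by (simp add: sum_distrib_left[symmetric])
  also have "(\<Prod>e\<in>\<Omega>. p * f e + (1 - p)) = (\<Prod>e\<in>D. p * exp (- 1) + (1 - p))"
    using fin D by (intro prod.mono_neutral_cong_right) (auto simp: f_def)
  \<comment> \<open>The crude bound 1/2 for \<open>exp (- 1)\<close> makes each factor at most 1 -
    p/2. The product is then at most \<open>exp (- 2 * a)\<close>, which beats the factor
    \<open>exp a\<close> from Markov's inequality.\<close>
  also have "\<dots> \<le> (\<Prod>e\<in>D. exp (- p / 2))"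
  proof (rule prod_mono, intro conjI)
    have "2 \<le> exp (1::real)"
      using exp_ge_add_one_self[of 1] by simp
    then have "exp (- 1) \<le> (1 / 2 :: real)"
      by (simp add: exp_minus field_simps)
    then have "p * exp (- 1) + (1 - p) \<le> p * (1 / 2) + (1 - p)"
      using p by (intro add_right_mono mult_left_mono) auto
    also have "\<dots> = 1 + (- p / 2)"
      by simp
    also have "\<dots> \<le> exp (- p / 2)"
      by (rule exp_ge_add_one_self)
    finally show "p * exp (- 1) + (1 - p) \<le> exp (- p / 2)" .
  qed (use p in auto)
  also have "\<dots> = exp (- 2 * a)"
    by (simp add: exp_of_nat_mult[symmetric] a_def)
  also have "exp a * exp (- 2 * a) = exp (- a)"
    by (simp add: exp_add[symmetric])
  finally show ?thesis
    by (simp add: a_def)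
qed

text \<open>
  A union bound over all packings \<open>F\<close>, each weighted by \<open>exp (a * (card F - \<rho>)) \<ge> 1\<close> so that the sum
  over all subfamilies factors into a product.
\<close>

lemma bernoulli_weight_packing:
  assumes fin: "finite \<Omega>" and \<F>: "\<F> \<subseteq> Pow \<Omega>" and p: "0 \<le> p" "p \<le> 1" and a: "0 \<le> a"
  shows "(\<Sum>E | E \<subseteq> \<Omega> \<and> (\<exists>F\<subseteq>\<F>. pairwise disjnt F \<and> \<Union>F \<subseteq> E \<and> \<rho> \<le> real (card F)).
      bernoulli_weight p \<Omega> E) \<le> exp (- a * \<rho>) * exp (exp a * (\<Sum>H\<in>\<F>. p ^ card H))"
proof -
  define P where "P = {F. F \<subseteq> \<F> \<and> pairwise disjnt F \<and> \<rho> \<le> real (card F)}"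
  have fin\<F>: "finite \<F>"
    using \<F> fin by (meson finite_Pow_iff finite_subset)
  have P: "P \<subseteq> Pow \<F>" and finP: "finite P"
    using fin\<F> by (auto simp: P_def)
  have "(\<Sum>E | E \<subseteq> \<Omega> \<and> (\<exists>F\<subseteq>\<F>. pairwise disjnt F \<and> \<Union>F \<subseteq> E \<and> \<rho> \<le> real (card F)).
      bernoulli_weight p \<Omega> E) = (\<Sum>E\<in>(\<Union>F\<in>P. {E. E \<subseteq> \<Omega> \<and> \<Union>F \<subseteq> E}). bernoulli_weight p \<Omega> E)"
    by (rule sum.cong) (auto simp: P_def)
  also have "\<dots> \<le> (\<Sum>F\<in>P. \<Sum>E | E \<subseteq> \<Omega> \<and> \<Union>F \<subseteq> E. bernoulli_weight p \<Omega> E)"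
    using fin finP by (intro sum_UNION_le) (auto simp: bernoulli_weight_nonneg[OF p])
  also have "\<dots> \<le> (\<Sum>F\<in>P. exp (- a * \<rho>) * (\<Prod>H\<in>F. exp a * p ^ card H))"
  proof (rule sum_mono)
    fix F assume F: "F \<in> P"
    then have sub: "\<Union>F \<subseteq> \<Omega>" and dis: "pairwise disjnt F" and \<rho>: "\<rho> \<le> real (card F)"
      using \<F> by (auto simp: P_def)
    \<comment> \<open>Disjointness makes the events \<open>H \<subseteq> E\<close> for
      \<open>H \<in> F\<close> independent, so their joint probability is a product.\<close>
    have "card (\<Union>F) = (\<Sum>H\<in>F. card H)"
      using dis sub fin by (intro card_Union_disjoint) (auto intro: finite_subset)
    then have "(\<Sum>E | E \<subseteq> \<Omega> \<and> \<Union>F \<subseteq> E. bernoulli_weight p \<Omega> E) = (\<Prod>H\<in>F. p ^ card H)"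
      by (simp add: bernoulli_weight_superset[OF fin sub] power_sum)
    also have "\<dots> \<le> exp (a * (real (card F) - \<rho>)) * (\<Prod>H\<in>F. p ^ card H)"
      using mult_right_mono[of 1 "exp (a * (real (card F) - \<rho>))" "\<Prod>H\<in>F. p ^ card H"] p a \<rho>
      by (simp add: prod_nonneg)
    also have "\<dots> = exp (- a * \<rho>) * (\<Prod>H\<in>F. exp a * p ^ card H)"
      by (simp add: prod.distrib exp_of_nat_mult[symmetric] exp_add[symmetric] algebra_simps)
    finally show "(\<Sum>E | E \<subseteq> \<Omega> \<and> \<Union>F \<subseteq> E. bernoulli_weight p \<Omega> E)
        \<le> exp (- a * \<rho>) * (\<Prod>H\<in>F. exp a * p ^ card H)" .
  qed
  also have "\<dots> \<le> (\<Sum>F\<in>Pow \<F>. exp (- a * \<rho>) * (\<Prod>H\<in>F. exp a * p ^ card H))"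
    using P fin\<F> p by (intro sum_mono2) (auto intro!: mult_nonneg_nonneg prod_nonneg)
  also have "\<dots> = exp (- a * \<rho>) * (\<Prod>H\<in>\<F>. exp a * p ^ card H + 1)"
    by (simp add: prod_add[OF fin\<F>] sum_distrib_left)
  also have "\<dots> \<le> exp (- a * \<rho>) * (\<Prod>H\<in>\<F>. exp (exp a * p ^ card H))"
    using p by (intro mult_left_mono prod_mono) (auto simp: exp_ge_add_one_self add.commute)
  also have "\<dots> = exp (- a * \<rho>) * exp (exp a * (\<Sum>H\<in>\<F>. p ^ card H))"
    by (simp add: exp_sum[OF fin\<F>] sum_distrib_left)
  finally show ?thesis .
qed

section \<open>Deletion of a maximal packing\<close>

text \<open>In the application \<open>\<Omega>\<close> is the set of all pairs, \<H> the bad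
  subgraphs, and \<D> the pair sets of the vertex sets that must not be independent. With positive
  probability a random \<open>E\<close> has many elements in every \<open>D\<close>, while no
  packing in \<open>E\<close> of bad sets meeting \<open>D\<close> is large enough to use them up.
  Deleting a maximum packing then destroys all bad sets and still leaves an element in each
  \<open>D\<close>.\<close>

lemma exists_avoiding_hitting:
  fixes \<H> \<D> :: "'a set set"
  assumes fin: "finite \<Omega>" and p: "0 < p" "p \<le> 1" and m: "0 < m"
    and \<H>: "\<And>H. H \<in> \<H> \<Longrightarrow> H \<subseteq> \<Omega> \<and> H \<noteq> {} \<and> card H \<le> m"
    and \<D>: "\<And>D. D \<in> \<D> \<Longrightarrow> D \<subseteq> \<Omega> \<and> card D = M"
    and few: "\<And>D. D \<in> \<D> \<Longrightarrow>
      exp (8 * real m) * (\<Sum>H | H \<in> \<H> \<and> H \<inter> D \<noteq> {}. p ^ card H) \<le> real M * p"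
    and union: "2 * real (card \<D>) * exp (- (real M * p / 4)) < 1"
  obtains E where "E \<subseteq> \<Omega>" "\<And>H. H \<in> \<H> \<Longrightarrow> \<not> H \<subseteq> E" "\<And>D. D \<in> \<D> \<Longrightarrow> E \<inter> D \<noteq> {}"
proof -
  \<comment> \<open>Fewer than \<rho> sets of size at most m cover fewer than M p / 4 elements, the
    threshold in \<open>A D\<close>.\<close>
  define \<rho> where "\<rho> = real M * p / (4 * real m)"
  define \<H>' where "\<H>' D = {H. H \<in> \<H> \<and> H \<inter> D \<noteq> {}}" for D
  define A where "A D = {E. E \<subseteq> \<Omega> \<and> real (card (E \<inter> D)) \<le> real (card D) * p / 4}" for D
  define B where "B D = {E. E \<subseteq> \<Omega> \<and> (\<exists>F\<subseteq>\<H>' D. pairwise disjnt F \<and> \<Union>F \<subseteq> E \<and> \<rho> \<le> real (card F))}" for D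
  have p': "0 \<le> p" using p by simp
  have fin\<H>: "finite \<H>"
    using \<H> fin by (intro finite_subset[of \<H> "Pow \<Omega>"]) auto
  have fin\<D>: "finite \<D>"
    using \<D> fin by (intro finite_subset[of \<D> "Pow \<Omega>"]) auto
  have finAB: "finite (A D)" "finite (B D)" for D
    using fin by (auto simp: A_def B_def)
  let ?w = "bernoulli_weight p \<Omega>"
  have tail: "sum ?w (A D \<union> B D) \<le> 2 * exp (- (real M * p / 4))" if D: "D \<in> \<D>" for D
  proof -
    have "sum ?w (A D \<union> B D) \<le> sum ?w (A D) + sum ?w (B D)"
      using finAB by (simp add: sum_Un bernoulli_weight_nonneg p p' sum_nonneg)
    also have "sum ?w (A D) \<le> exp (- (real M * p / 4))"
      using bernoulli_weight_lower_tail[OF fin, of D p] \<D>[OF D] p by (auto simp: A_def)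
    \<comment> \<open>With a = 8 m the first exponent is -2 M p, and hypothesis \<open>few\<close>
      caps the second at M p, so \<open>exp (- (M * p))\<close> remains.\<close>
    also have "sum ?w (B D) \<le> exp (- (8 * real m) * \<rho>) * exp (exp (8 * real m) * (\<Sum>H\<in>\<H>' D. p ^ card H))"
      unfolding B_def using \<H> p by (intro bernoulli_weight_packing[OF fin]) (auto simp: \<H>'_def)
    also have "\<dots> \<le> exp (- (8 * real m) * \<rho>) * exp (real M * p)"
      using few[OF D] by (simp add: \<H>'_def)
    also have "\<dots> = exp (- (real M * p))"
      using m by (simp add: \<rho>_def exp_add[symmetric])
    also have "\<dots> \<le> exp (- (real M * p / 4))"
      using p by simp
    finally show ?thesis by simp
  qed
  have "sum ?w (\<Union>D\<in>\<D>. A D \<union> B D) \<le> (\<Sum>D\<in>\<D>. sum ?w (A D \<union> B D))"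
    using fin\<D> finAB by (intro sum_UNION_le) (auto simp: bernoulli_weight_nonneg p p')
  also have "\<dots> \<le> (\<Sum>D\<in>\<D>. 2 * exp (- (real M * p / 4)))"
    by (intro sum_mono tail)
  also have "\<dots> < sum ?w (Pow \<Omega>)"
    using union by (simp add: bernoulli_weight_sum[OF fin] mult_ac)
  \<comment> \<open>The failure events have total weight below 1, so some outcome avoids them
    all.\<close>
  finally have "sum ?w (\<Union>D\<in>\<D>. A D \<union> B D) \<noteq> sum ?w (Pow \<Omega>)"
    by simp
  moreover have "(\<Union>D\<in>\<D>. A D \<union> B D) \<subseteq> Pow \<Omega>"
    by (auto simp: A_def B_def)
  ultimately have "\<not> Pow \<Omega> \<subseteq> (\<Union>D\<in>\<D>. A D \<union> B D)"
    by (metis subset_antisym)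
  then obtain E where E: "E \<subseteq> \<Omega>" and notAB: "\<And>D. D \<in> \<D> \<Longrightarrow> E \<notin> A D \<and> E \<notin> B D"
    by blast
  have finE: "finite E"
    using E fin by (rule finite_subset)
  \<comment> \<open>The packing is chosen for \<open>E\<close> alone, without regard to
    \<open>D\<close>, so one deletion serves all of \<D> at once.\<close>
  define P where "P = {F. F \<subseteq> \<H> \<and> pairwise disjnt F \<and> \<Union>F \<subseteq> E}"
  have "finite P"
    using fin\<H> by (simp add: P_def)
  moreover have "{} \<in> P"
    by (simp add: P_def)
  ultimately have "Max (card ` P) \<in> card ` P"
    by (metis Max_in empty_iff finite_imageI image_is_empty)
  then obtain F where F: "F \<in> P" and "card F = Max (card ` P)"
    by auto
  then have max: "card F' \<le> card F" if "F' \<in> P" for F'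
    using that \<open>finite P\<close> by simp
  have finF: "finite F"
    using F fin\<H> by (auto simp: P_def intro: finite_subset)
  show thesis
  proof (rule that[of "E - \<Union>F"])
    show "E - \<Union>F \<subseteq> \<Omega>"
      using E by blast
  next
    fix H assume H: "H \<in> \<H>"
    show "\<not> H \<subseteq> E - \<Union>F"
    proof
      assume sub: "H \<subseteq> E - \<Union>F"
      then have "insert H F \<in> P"
        using F H by (auto simp: P_def pairwise_insert disjnt_def)
      \<comment> \<open>A member of \<open>F\<close> disjoint from \<open>\<Union>F\<close> would be
        empty. So adding \<open>H\<close> really enlarges the packing, against maximality.\<close>
      moreover have "H \<notin> F"
        using sub \<H>[OF H] by blast
      ultimately show False
        using max[of "insert H F"] finF by simp
    qed
  next
    fix D assume D: "D \<in> \<D>"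
    \<comment> \<open>Only the members of \<open>F\<close> meeting \<open>D\<close> remove elements
      of \<open>D\<close>. If they removed all of \<open>E \<inter> D\<close>, there would be at
      least \<rho> of them, which puts \<open>E\<close> into \<open>B D\<close>.\<close>
    define F' where "F' = F \<inter> \<H>' D"
    show "(E - \<Union>F) \<inter> D \<noteq> {}"
    proof
      assume "(E - \<Union>F) \<inter> D = {}"
      then have "E \<inter> D \<subseteq> \<Union>F'"
        using F by (fastforce simp: F'_def \<H>'_def P_def)
      moreover have "\<Union>F' \<subseteq> E" "pairwise disjnt F'"
        using F by (auto simp: F'_def P_def pairwise_def)
      ultimately have "card (E \<inter> D) \<le> card (\<Union>F')"
        using finE by (meson card_mono finite_subset)
      also have "\<dots> \<le> (\<Sum>H\<in>F'. card H)"
        by (rule card_Union_le_sum_card)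
      also have "\<dots> \<le> card F' * m"
        using \<H> by (intro order.trans[OF sum_bounded_above[of F' card m]]) (auto simp: F'_def \<H>'_def)
      finally have "real (card (E \<inter> D)) \<le> real (card F') * real m"
        by (metis of_nat_le_iff of_nat_mult)
      moreover have "real (card (E \<inter> D)) > real M * p / 4"
        using notAB[OF D] E \<D>[OF D] by (auto simp: A_def)
      ultimately have "\<rho> \<le> real (card F')"
        using m by (simp add: \<rho>_def field_simps)
      then have "E \<in> B D"
        unfolding B_def using \<open>\<Union>F' \<subseteq> E\<close> \<open>pairwise disjnt F'\<close> E by (auto simp: F'_def)
      then show False
        using notAB[OF D] by blast
    qed
  qed
qed

section \<open>Locally sparse graphs without large independent sets\<close>

text \<open>Bad subgraphs are recorded by their numbers of vertices and edges only, whatever their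
  shape. On a finite vertex set, avoiding the whole family means that every v-set spans fewer than e
  edges.\<close>

definition local_edge_sets :: "'a set \<Rightarrow> nat \<Rightarrow> nat \<Rightarrow> 'a set set set"
  where "local_edge_sets V v e = {H. card H = e \<and> (\<exists>W\<in>[V]\<^bsup>v\<^esup>. H \<subseteq> [W]\<^bsup>2\<^esup>)}"

lemma local_edge_sets_subset: "H \<in> local_edge_sets V v e \<Longrightarrow> H \<subseteq> [V]\<^bsup>2\<^esup>"
  using nsets_mono by (fastforce simp: local_edge_sets_def nsets_def)

lemma finite_local_edge_sets: "finite V \<Longrightarrow> finite (local_edge_sets V v e)"
  by (rule finite_subset[of _ "Pow ([V]\<^bsup>2\<^esup>)"])
    (auto simp: finite_imp_finite_nsets dest: local_edge_sets_subset)

section \<open>Counting local edge sets\<close>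

lemma binomial_le_power: "n choose k \<le> n ^ k"
  by (cases "k \<le> n") (simp_all add: binomial_le_pow binomial_eq_0)

lemma card_supersets_le:
  assumes "finite V"
  shows "card {W \<in> [V]\<^bsup>v\<^esup>. f \<subseteq> W} \<le> card V ^ (v - card f)"
proof -
  have "card {W \<in> [V]\<^bsup>v\<^esup>. f \<subseteq> W} \<le> card ([V]\<^bsup>(v - card f)\<^esup>)"
  proof (rule card_inj_on_le)
    show "inj_on (\<lambda>W. W - f) {W \<in> [V]\<^bsup>v\<^esup>. f \<subseteq> W}"
      by (rule inj_onI) blast
    show "(\<lambda>W. W - f) ` {W \<in> [V]\<^bsup>v\<^esup>. f \<subseteq> W} \<subseteq> [V]\<^bsup>(v - card f)\<^esup>"
      by (auto simp: nsets_def card_Diff_subset finite_subset)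
    show "finite ([V]\<^bsup>(v - card f)\<^esup>)"
      using assms by (rule finite_imp_finite_nsets)
  qed
  also have "\<dots> \<le> card V ^ (v - card f)"
    by (simp add: binomial_le_power)
  finally show ?thesis .
qed

text \<open>A v-set around the pair f is fixed by its other v - 2 vertices, and inside it any set of
  pairs is allowed.\<close>

lemma card_local_edge_sets_containing_le:
  assumes fin: "finite V" and f: "card f = 2"
  shows "card {H \<in> local_edge_sets V v e. f \<in> H} \<le> 2 ^ (v choose 2) * card V ^ (v - 2)"
proof -
  define \<W> where "\<W> = {W \<in> [V]\<^bsup>v\<^esup>. f \<subseteq> W}"
  have fin\<W>: "finite \<W>"
    using fin by (simp add: \<W>_def finite_imp_finite_nsets)
  have W: "finite ([W]\<^bsup>2\<^esup>)" "card ([W]\<^bsup>2\<^esup>) = v choose 2" if "W \<in> \<W>" for W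
    using that by (auto simp: \<W>_def nsets_def[of V] finite_imp_finite_nsets)
  have "{H \<in> local_edge_sets V v e. f \<in> H} \<subseteq> (\<Union>W\<in>\<W>. Pow ([W]\<^bsup>2\<^esup>))"
  proof clarify
    fix H assume "H \<in> local_edge_sets V v e" "f \<in> H"
    then obtain W where "W \<in> [V]\<^bsup>v\<^esup>" "H \<subseteq> [W]\<^bsup>2\<^esup>"
      by (auto simp: local_edge_sets_def)
    moreover from this \<open>f \<in> H\<close> have "f \<subseteq> W"
      by (auto simp: nsets_def[of W])
    ultimately show "H \<in> (\<Union>W\<in>\<W>. Pow ([W]\<^bsup>2\<^esup>))"
      by (auto simp: \<W>_def)
  qed
  then have "card {H \<in> local_edge_sets V v e. f \<in> H} \<le> card (\<Union>W\<in>\<W>. Pow ([W]\<^bsup>2\<^esup>))"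
    using fin\<W> W by (intro card_mono) auto
  also have "\<dots> \<le> (\<Sum>W\<in>\<W>. card (Pow ([W]\<^bsup>2\<^esup>)))"
    by (rule card_UN_le[OF fin\<W>])
  also have "\<dots> = 2 ^ (v choose 2) * card \<W>"
    using W by (simp add: card_Pow)
  also have "\<dots> \<le> 2 ^ (v choose 2) * card V ^ (v - 2)"
    using card_supersets_le[OF fin, of v f] f by (simp add: \<W>_def)
  finally show ?thesis .
qed

text \<open>The left side is the expected number of local edge sets in the random graph that meet
  \<open>D\<close>; each is charged to an edge it shares with \<open>D\<close>.\<close>

lemma sum_local_edge_sets_meeting_le:
  assumes fin: "finite V" and D: "D \<subseteq> [V]\<^bsup>2\<^esup>" and p: "0 \<le> p"
  shows "(\<Sum>H | H \<in> local_edge_sets V v e \<and> H \<inter> D \<noteq> {}. p ^ card H)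
    \<le> real (card D) * (2 ^ (v choose 2) * real (card V) ^ (v - 2) * p ^ e)"
proof -
  have finD: "finite D"
    using D finite_imp_finite_nsets[OF fin] by (rule finite_subset)
  have "(\<Sum>H | H \<in> local_edge_sets V v e \<and> H \<inter> D \<noteq> {}. p ^ card H)
      = (\<Sum>H\<in>(\<Union>f\<in>D. {H \<in> local_edge_sets V v e. f \<in> H}). p ^ card H)"
    by (rule sum.cong) auto
  also have "\<dots> \<le> (\<Sum>f\<in>D. \<Sum>H | H \<in> local_edge_sets V v e \<and> f \<in> H. p ^ card H)"
    using finD p finite_local_edge_sets[OF fin] by (intro sum_UNION_le) auto
  also have "\<dots> = (\<Sum>f\<in>D. real (card {H \<in> local_edge_sets V v e. f \<in> H}) * p ^ e)"
    by (simp add: local_edge_sets_def)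
  also have "\<dots> \<le> (\<Sum>f\<in>D. real (2 ^ (v choose 2) * card V ^ (v - 2)) * p ^ e)"
    using D p by (intro sum_mono mult_right_mono of_nat_mono card_local_edge_sets_containing_le fin)
      (auto simp: nsets_def)
  finally show ?thesis
    by simp
qed

section \<open>The random graph with deletions\<close>

text \<open>The condition v - 2 \<le> \<alpha> (e - 1) says that at density \<delta> n^(-\<alpha>)
  the expected number of bad sets through a given edge is at most a constant times \<delta> p. A
  small \<delta> absorbs the constant and the factor \<open>exp (8 * m)\<close> of the deletion
  lemma.\<close>

lemma exists_locally_sparse_graph:
  fixes X :: "(nat \<times> nat) set" and \<alpha> \<delta> :: real
  assumes fin: "finite V" and V: "2 \<le> card V" and finX: "finite X" and m: "0 < m"
    and X: "\<And>v e. (v, e) \<in> X \<Longrightarrow> v \<le> w \<and> 2 \<le> e \<and> e \<le> m \<and> real (v - 2) \<le> \<alpha> * real (e - 1)"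
    and \<alpha>: "0 \<le> \<alpha>" and \<delta>: "0 < \<delta>" "\<delta> \<le> 1" "exp (8 * real m) * (real (card X) * 2 ^ (w choose 2) * \<delta>) \<le> 1"
  obtains E where "E \<subseteq> [V]\<^bsup>2\<^esup>"
    and "\<And>v e W. (v, e) \<in> X \<Longrightarrow> W \<in> [V]\<^bsup>v\<^esup> \<Longrightarrow> card (E \<inter> [W]\<^bsup>2\<^esup>) < e"
    and "\<And>U. U \<subseteq> V \<Longrightarrow> 32 / \<delta> * real (card V) powr \<alpha> * ln (real (card V)) \<le> real (card U) \<Longrightarrow>
      E \<inter> [U]\<^bsup>2\<^esup> \<noteq> {}"
proof -
  define n where "n = card V"
  define p where "p = \<delta> * real n powr - \<alpha>"
  define \<tau> where "\<tau> = 32 / \<delta> * real n powr \<alpha> * ln (real n)"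
  \<comment> \<open>Every set of size at least \<tau> contains a t-set, so it suffices to hit the
    pair sets of t-sets.\<close>
  define t where "t = nat \<lceil>\<tau>\<rceil>"
  define \<H> where "\<H> = (\<Union>(v, e)\<in>X. local_edge_sets V v e)"
  define \<D> where "\<D> = (\<lambda>U. [U]\<^bsup>2\<^esup>) ` ([V]\<^bsup>t\<^esup>)"
  have n: "2 \<le> n"
    using V by (simp add: n_def)
  have p: "0 < p" "p \<le> 1"
    using n \<delta> \<alpha> powr_mono[of "- \<alpha>" 0 "real n"] by (auto simp: p_def mult_le_one)
  have ln_n: "1 / 2 \<le> ln (real n)"
  proof -
    have "ln (1 / real n) \<le> 1 / real n - 1"
      using n by (intro ln_le_minus_one) simp
    moreover have "1 / real n \<le> 1 / 2"
      using n by (intro divide_left_mono) auto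
    moreover have "ln (1 / real n) = - ln (real n)"
      using n by (simp add: ln_div)
    ultimately show ?thesis by linarith
  qed
  have p\<tau>: "p * \<tau> = 32 * ln (real n)"
    using n \<delta> by (simp add: p_def \<tau>_def powr_minus field_simps)
  have \<tau>: "\<tau> \<le> real t"
    unfolding t_def by (rule real_nat_ceiling_ge)
  have pt: "32 * ln (real n) \<le> p * real t"
    using \<tau> p p\<tau> by (metis mult_left_mono less_imp_le)
  have t: "4 \<le> t"
  proof -
    have "p * real t \<le> 1 * real t"
      using p by (intro mult_right_mono) auto
    then show ?thesis
      using pt ln_n by linarith
  qed
  \<comment> \<open>The constant 32 is used up here: a factor 16 is lost in passing from t (p t) to
    (t choose 2) p / 4, using t - 1 \<ge> t/2. The resulting 2 t ln n pays for the n^t sets and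
    leaves n^(-t).\<close>
  have M: "real (t choose 2) * p / 4 \<ge> 2 * real t * ln (real n)"
  proof -
    have "2 * real t * ln (real n) = real t * (32 * ln (real n)) / 16"
      by simp
    also have "\<dots> \<le> real t * (p * real t) / 16"
      using pt by (intro divide_right_mono mult_left_mono) auto
    also have "\<dots> = real t * (real t / 2) * p / 8"
      by simp
    also have "\<dots> \<le> real t * (real t - 1) * p / 8"
      using t p by (intro divide_right_mono mult_right_mono mult_left_mono) auto
    also have "\<dots> = real (t choose 2) * p / 4"
      using t by (simp add: choose_two real_of_nat_div of_nat_diff)
    finally show ?thesis .
  qed
  have few: "exp (8 * real m) * (\<Sum>H | H \<in> \<H> \<and> H \<inter> D \<noteq> {}. p ^ card H) \<le> real (t choose 2) * p"
    if D: "D \<subseteq> [V]\<^bsup>2\<^esup>" "card D = t choose 2" for D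
  proof -
    have term_le: "2 ^ (v choose 2) * real n ^ (v - 2) * p ^ e \<le> 2 ^ (w choose 2) * \<delta> * p"
      if "(v, e) \<in> X" for v e
    proof -
      have ve: "v \<le> w" "2 \<le> e" "real (v - 2) \<le> \<alpha> * real (e - 1)"
        using X[OF that] by auto
      \<comment> \<open>Only e - 1 factors p are spent against the n^(v - 2) choices. The last one
        is kept, to compare with the expected number of edges (t choose 2) p.\<close>
      have "real n ^ (v - 2) * (real n powr - \<alpha>) ^ (e - 1) =
          real n powr real (v - 2) * real n powr (- \<alpha> * real (e - 1))"
        using n by (simp add: powr_realpow powr_power mult.commute)
      also have "\<dots> = real n powr (real (v - 2) - \<alpha> * real (e - 1))"
        by (simp only: powr_add[symmetric]) simp
      finally have "real n ^ (v - 2) * p ^ (e - 1) =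
          real n powr (real (v - 2) - \<alpha> * real (e - 1)) * \<delta> ^ (e - 1)"
        by (simp add: p_def power_mult_distrib mult_ac)
      \<comment> \<open>The exponent of n is nonpositive, and e \<ge> 2 leaves at least one factor
        \<delta>.\<close>
      also have "\<dots> \<le> 1 * \<delta> ^ 1"
        using n ve \<delta> powr_mono[of "real (v - 2) - \<alpha> * real (e - 1)" 0 "real n"]
        by (intro mult_mono power_decreasing) auto
      finally have "real n ^ (v - 2) * p ^ (e - 1) \<le> \<delta>"
        by simp
      then have "2 ^ (v choose 2) * (real n ^ (v - 2) * p ^ (e - 1)) * p \<le> 2 ^ (w choose 2) * \<delta> * p"
        using ve p by (intro mult_right_mono mult_mono power_increasing binomial_right_mono) auto
      moreover have "p ^ e = p ^ (e - 1) * p"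
        using ve by (cases e) auto
      ultimately show ?thesis
        by (simp add: mult_ac)
    qed
    have "(\<Sum>H | H \<in> \<H> \<and> H \<inter> D \<noteq> {}. p ^ card H) =
        (\<Sum>H\<in>(\<Union>(v, e)\<in>X. {H \<in> local_edge_sets V v e. H \<inter> D \<noteq> {}}). p ^ card H)"
      by (rule sum.cong) (auto simp: \<H>_def)
    also have "\<dots> \<le> (\<Sum>x\<in>X. \<Sum>H\<in>(case x of (v, e) \<Rightarrow> {H \<in> local_edge_sets V v e. H \<inter> D \<noteq> {}}). p ^ card H)"
      using finX p finite_local_edge_sets[OF fin] by (intro sum_UNION_le) auto
    also have "\<dots> \<le> (\<Sum>x\<in>X. real (t choose 2) * (2 ^ (w choose 2) * \<delta> * p))"
    proof (rule sum_mono, clarify)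
      fix v e assume "(v, e) \<in> X"
      from mult_left_mono[OF term_le[OF this], of "real (t choose 2)"]
        sum_local_edge_sets_meeting_le[OF fin D(1), of p v e] p D(2)
      show "(\<Sum>H | H \<in> local_edge_sets V v e \<and> H \<inter> D \<noteq> {}. p ^ card H) \<le> real (t choose 2) * (2 ^ (w choose 2) * \<delta> * p)"
        by (simp add: n_def)
    qed
    also have "\<dots> = real (card X) * 2 ^ (w choose 2) * \<delta> * (real (t choose 2) * p)"
      by simp
    finally have "exp (8 * real m) * (\<Sum>H | H \<in> \<H> \<and> H \<inter> D \<noteq> {}. p ^ card H) \<le>
        exp (8 * real m) * (real (card X) * 2 ^ (w choose 2) * \<delta>) * (real (t choose 2) * p)"
      by (simp add: mult.assoc)
    also have "\<dots> \<le> 1 * (real (t choose 2) * p)"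
      using p by (intro mult_right_mono \<delta>) auto
    finally show ?thesis by simp
  qed
  have union: "2 * real (card \<D>) * exp (- (real (t choose 2) * p / 4)) < 1"
  proof -
    have "card \<D> \<le> card ([V]\<^bsup>t\<^esup>)"
      unfolding \<D>_def using fin by (intro card_image_le finite_imp_finite_nsets)
    also have "\<dots> \<le> n ^ t"
      by (simp add: n_def binomial_le_power)
    finally have "real (card \<D>) \<le> exp (real t * ln (real n))"
      using n by (simp add: exp_of_nat_mult flip: of_nat_power)
    moreover have "exp (- (real (t choose 2) * p / 4)) \<le> exp (- 2 * real t * ln (real n))"
      using M by simp
    ultimately have "2 * real (card \<D>) * exp (- (real (t choose 2) * p / 4))
        \<le> 2 * exp (real t * ln (real n)) * exp (- 2 * real t * ln (real n))"
      by (intro mult_mono) auto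
    also have "\<dots> = 2 * exp (- (real t * ln (real n)))"
      by (simp add: exp_add[symmetric])
    also have "\<dots> \<le> 2 * exp (- 2)"
    proof -
      have "4 * (1 / 2) \<le> real t * ln (real n)"
        using t ln_n by (intro mult_mono) auto
      then show ?thesis by simp
    qed
    also have "\<dots> < 1"
      using exp_ge_add_one_self[of 2] by (simp add: exp_minus field_simps)
    finally show ?thesis .
  qed
  obtain E where E: "E \<subseteq> [V]\<^bsup>2\<^esup>" "\<And>H. H \<in> \<H> \<Longrightarrow> \<not> H \<subseteq> E" "\<And>D. D \<in> \<D> \<Longrightarrow> E \<inter> D \<noteq> {}"
  proof (rule exists_avoiding_hitting[of "[V]\<^bsup>2\<^esup>" p m \<H> \<D> "t choose 2"])
    show "H \<subseteq> [V]\<^bsup>2\<^esup> \<and> H \<noteq> {} \<and> card H \<le> m" if "H \<in> \<H>" for H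
    proof -
      obtain v e where ve: "(v, e) \<in> X" and H: "H \<in> local_edge_sets V v e"
        using \<open>H \<in> \<H>\<close> by (auto simp: \<H>_def)
      then have "card H = e"
        by (simp add: local_edge_sets_def)
      with X[OF ve] local_edge_sets_subset[OF H] show ?thesis
        by auto
    qed
    show D: "D \<subseteq> [V]\<^bsup>2\<^esup> \<and> card D = t choose 2" if "D \<in> \<D>" for D
    proof -
      obtain U where U: "U \<in> [V]\<^bsup>t\<^esup>" "D = [U]\<^bsup>2\<^esup>"
        using \<open>D \<in> \<D>\<close> by (auto simp: \<D>_def)
      then have "U \<subseteq> V" "card U = t"
        by (auto simp: nsets_def)
      then show ?thesis
        unfolding U(2) by (simp add: nsets_mono)
    qed
    show "exp (8 * real m) * (\<Sum>H | H \<in> \<H> \<and> H \<inter> D \<noteq> {}. p ^ card H) \<le> real (t choose 2) * p"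
      if "D \<in> \<D>" for D
      using D[OF that] few by blast
  qed (use fin p m union in \<open>auto simp: finite_imp_finite_nsets\<close>)
  show thesis
  proof (rule that[OF E(1)])
    fix v e W assume ve: "(v, e) \<in> X" and W: "W \<in> [V]\<^bsup>v\<^esup>"
    show "card (E \<inter> [W]\<^bsup>2\<^esup>) < e"
    proof (rule ccontr)
      assume "\<not> card (E \<inter> [W]\<^bsup>2\<^esup>) < e"
      \<comment> \<open>Members of \<H> have exactly e edges, so a violating edge set is first
        trimmed to size e.\<close>
      then obtain H where "H \<subseteq> E \<inter> [W]\<^bsup>2\<^esup>" "card H = e"
        by (meson not_less obtain_subset_with_card_n)
      with ve W E(2)[of H] show False
        by (auto simp: \<H>_def local_edge_sets_def)
    qed
  next
    fix U assume U: "U \<subseteq> V" and "32 / \<delta> * real (card V) powr \<alpha> * ln (real (card V)) \<le> real (card U)"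
    then have "t \<le> card U"
      by (simp add: t_def \<tau>_def n_def nat_le_iff ceiling_le_iff)
    then obtain U' where U': "U' \<subseteq> U" "card U' = t" "finite U'"
      by (meson obtain_subset_with_card_n)
    then have "[U']\<^bsup>2\<^esup> \<in> \<D>"
      using U by (auto simp: \<D>_def nsets_def[of V])
    then have "E \<inter> [U']\<^bsup>2\<^esup> \<noteq> {}"
      by (rule E(3))
    then show "E \<inter> [U]\<^bsup>2\<^esup> \<noteq> {}"
      using nsets_mono[OF U'(1), of 2] by blast
  qed
qed

section \<open>Shattered sets\<close>

text \<open>Subsets of size k - 2 are used because those of size k - 1 number only k and might all
  be cut out by vertices of \<open>S\<close> itself.\<close>

lemma shatters_imp_dense:
  assumes fin: "finite V" and S: "S \<subseteq> V" "card S = k" and k: "5 \<le> k"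
    and shat: "shatters (neighbourhood E ` V) S"
  obtains W where "W \<in> [V]\<^bsup>(2 * k)\<^esup>" "k * (k - 2) \<le> card (E \<inter> [W]\<^bsup>2\<^esup>)"
proof -
  have finS: "finite S"
    using S fin by (blast intro: finite_subset)
  define \<B> where "\<B> = {B. B \<subseteq> S \<and> card B = k - 2}"
  have "\<forall>B\<in>\<B>. \<exists>v\<in>V. neighbourhood E v \<inter> S = B"
    using shat by (auto simp: shatters_def \<B>_def)
  then obtain x where x: "\<And>B. B \<in> \<B> \<Longrightarrow> x B \<in> V \<and> neighbourhood E (x B) \<inter> S = B"
    by metis
  \<comment> \<open>A vertex has only one trace on \<open>S\<close>, so different subsets need
    different vertices.\<close>
  have "inj_on x \<B>"
    using x by (metis inj_onI)
  moreover have "card \<B> = k choose 2"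
    using finS S k by (simp add: \<B>_def n_subsets binomial_symmetric[of 2 k])
  ultimately have "card (x ` \<B>) = k choose 2"
    by (simp add: card_image)
  \<comment> \<open>This is where k \<ge> 5 enters. Discarding the at most k vertices inside
    \<open>S\<close> leaves at least k outside.\<close>
  moreover have "2 * k \<le> k choose 2"
  proof -
    have "k * 4 \<le> k * (k - 1)"
      using k by (intro mult_left_mono) auto
    then show ?thesis
      unfolding choose_two by linarith
  qed
  moreover have "card (x ` \<B>) - card S \<le> card (x ` \<B> - S)"
    using finS by (rule diff_card_le_card_Diff)
  ultimately have "k \<le> card (x ` \<B> - S)"
    using S by simp
  then obtain T where T: "T \<subseteq> x ` \<B> - S" "card T = k" "finite T"
    by (meson obtain_subset_with_card_n)
  have deg: "card (neighbourhood E v \<inter> S) = k - 2" if "v \<in> T" for v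
    using that T x by (auto simp: \<B>_def)
  define P where "P = (SIGMA v:T. neighbourhood E v \<inter> S)"
  have "k * (k - 2) = card P"
    using T finS by (simp add: P_def deg)
  also have "\<dots> \<le> card (E \<inter> [S \<union> T]\<^bsup>2\<^esup>)"
  proof (rule card_inj_on_le)
    \<comment> \<open>Since \<open>T\<close> avoids \<open>S\<close>, an edge determines which end
      lies in \<open>T\<close>, so no edge is counted twice.\<close>
    show "inj_on (\<lambda>(v, u). {v, u}) P"
      using T by (auto simp: inj_on_def P_def doubleton_eq_iff)
    show "(\<lambda>(v, u). {v, u}) ` P \<subseteq> E \<inter> [S \<union> T]\<^bsup>2\<^esup>"
      by (auto simp: P_def neighbourhood_def)
    show "finite (E \<inter> [S \<union> T]\<^bsup>2\<^esup>)"
      using finS T by (simp add: finite_imp_finite_nsets)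
  qed
  finally have "k * (k - 2) \<le> card (E \<inter> [S \<union> T]\<^bsup>2\<^esup>)" .
  moreover have "card (S \<union> T) = 2 * k"
    using T S finS by (subst card_Un_disjoint) auto
  then have "S \<union> T \<in> [V]\<^bsup>(2 * k)\<^esup>"
    using T S x finS by (auto simp: nsets_def)
  ultimately show thesis
    using that by blast
qed

lemma shatters_subset:
  assumes "shatters \<F> S" "S' \<subseteq> S"
  shows "shatters \<F> S'"
  unfolding shatters_def
proof (intro allI impI)
  fix B assume "B \<subseteq> S'"
  then obtain A where "A \<in> \<F>" "A \<inter> S = B"
    using assms by (metis order_trans shatters_def)
  moreover from this have "A \<inter> S' = B"
    using assms(2) \<open>B \<subseteq> S'\<close> by blast
  ultimately show "\<exists>A\<in>\<F>. A \<inter> S' = B"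
    by blast
qed

section \<open>Choice of parameters\<close>

theorem theorem2:
  shows "\<exists>c :: nat \<Rightarrow> real. \<forall>s d :: nat. 3 \<le> s \<longrightarrow> 5 \<le> d \<longrightarrow> s + 2 \<le> d \<longrightarrow>
    0 < c d \<and>
    (\<forall>n\<ge>2. \<exists>(V :: nat set) E.
       simple_graph V E \<and> card V = n \<and> K_free s V E \<and> graph_vc_dim V E \<le> enat d \<and>
       \<not> (\<exists>I\<subseteq>V. indep I E \<and>
            c d * real n powr (2 / (real s + 1)) * ln (real n) \<le> real (card I)))"
proof -
  \<comment> \<open>The smallness condition on \<delta> with equality, for m = k^2, w = 2 k and two
    forbidden pairs. As s < k, these bounds cover every admissible s, so \<delta> depends on d
    alone.\<close>
  define \<delta> :: "nat \<Rightarrow> real"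
    where "\<delta> d = 1 / (exp (8 * real ((d + 1)\<^sup>2)) * (2 * 2 ^ (2 * (d + 1) choose 2)))" for d
  show ?thesis
  proof (intro exI[of _ "\<lambda>d. 32 / \<delta> d"] allI impI conjI)
    fix s d :: nat
    show "0 < 32 / \<delta> d"
      by (simp add: \<delta>_def)
    assume s: "3 \<le> s" and d: "5 \<le> d" "s + 2 \<le> d"
    fix n :: nat assume n: "2 \<le> n"
    define k where "k = d + 1"
    \<comment> \<open>The first pair forbids copies of K_s, the second the dense sets produced by a
      shattered k-set.\<close>
    define X where "X = {(s, s choose 2), (2 * k, k * (k - 2))}"
    define V where "V = {..<n}"
    have k: "6 \<le> k" "s + 3 \<le> k"
      using d by (auto simp: k_def)
    have choose_s: "real (s choose 2) = real s * (real s - 1) / 2"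
      using s by (simp add: choose_two real_of_nat_div of_nat_diff)
    obtain E where E: "E \<subseteq> [V]\<^bsup>2\<^esup>"
      and sparse: "\<And>v e W. (v, e) \<in> X \<Longrightarrow> W \<in> [V]\<^bsup>v\<^esup> \<Longrightarrow> card (E \<inter> [W]\<^bsup>2\<^esup>) < e"
      and large: "\<And>U. U \<subseteq> V \<Longrightarrow>
        32 / \<delta> d * real (card V) powr (2 / (real s + 1)) * ln (real (card V)) \<le> real (card U) \<Longrightarrow>
        E \<inter> [U]\<^bsup>2\<^esup> \<noteq> {}"
    proof (rule exists_locally_sparse_graph[of V X "k\<^sup>2" "2 * k" "2 / (real s + 1)" "\<delta> d"])
      fix v e assume "(v, e) \<in> X"
      then consider "v = s" "e = s choose 2" | "v = 2 * k" "e = k * (k - 2)"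
        by (auto simp: X_def)
      then show "v \<le> 2 * k \<and> 2 \<le> e \<and> e \<le> k\<^sup>2 \<and> real (v - 2) \<le> 2 / (real s + 1) * real (e - 1)"
      proof cases
        case 1
        have "s * 2 \<le> s * (s - 1)"
          using s by (intro mult_left_mono) auto
        then have "2 \<le> e"
          unfolding 1 choose_two using s by linarith
        moreover have "e \<le> k\<^sup>2"
        proof -
          have "s choose 2 \<le> s ^ 2"
            by (rule binomial_le_power)
          also have "\<dots> \<le> k ^ 2"
            using k by (intro power_mono) auto
          finally show ?thesis by (simp add: 1)
        qed
        \<comment> \<open>For K_s the density condition is an equality, since (s choose 2) - 1 = (s
          - 2)(s + 1)/2. This fixes the exponent 2/(s + 1).\<close>
        moreover have e: "real (e - 1) = (real s - 2) * (real s + 1) / 2"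
          using \<open>2 \<le> e\<close> choose_s by (simp add: 1 of_nat_diff field_simps)
        then have "real (v - 2) \<le> 2 / (real s + 1) * real (e - 1)"
          unfolding e using 1(1) s by (simp add: of_nat_diff)
        ultimately show ?thesis
          using 1(1) k by simp
      next
        case 2
        have "6 * 4 \<le> k * (k - 2)"
          using k by (intro mult_mono) auto
        then have e: "real (e - 1) = real k * (real k - 2) - 1"
          using k by (simp add: 2 of_nat_diff)
        \<comment> \<open>This is where d \<ge> s + 2 enters, as s + 1 \<le> k - 2. The next step
          amounts to k \<ge> 3.\<close>
        have "(2 * real k - 2) * (real s + 1) \<le> (2 * real k - 2) * (real k - 2)"
          using k by (intro mult_left_mono) auto
        also have "\<dots> \<le> 2 * (real k * (real k - 2) - 1)"
          using k by (simp add: algebra_simps)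
        finally have "real (v - 2) \<le> 2 / (real s + 1) * real (e - 1)"
          using k unfolding e by (simp add: 2 of_nat_diff field_simps)
        then show ?thesis
          using \<open>6 * 4 \<le> k * (k - 2)\<close> by (simp add: 2 power2_eq_square)
      qed
    next
      have one: "1 \<le> exp (8 * real (k\<^sup>2)) * (2 * 2 ^ (2 * k choose 2))"
      proof -
        have "1 * (1 * 1) \<le> exp (8 * real (k\<^sup>2)) * (2 * 2 ^ (2 * k choose 2))"
          by (intro mult_mono) auto
        then show ?thesis by simp
      qed
      show "0 < \<delta> d"
        by (simp add: \<delta>_def)
      show "\<delta> d \<le> 1"
        using one by (simp add: \<delta>_def k_def)
      have "real (card X) \<le> 2"
        using card_insert_le_m1[of 2 "{(2 * k, k * (k - 2))}" "(s, s choose 2)"] by (simp add: X_def)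
      then have "exp (8 * real (k\<^sup>2)) * (real (card X) * 2 ^ (2 * k choose 2) * \<delta> d)
          \<le> exp (8 * real (k\<^sup>2)) * (2 * 2 ^ (2 * k choose 2) * \<delta> d)"
        using \<open>0 < \<delta> d\<close> by (intro mult_left_mono mult_right_mono) auto
      also have "\<dots> = 1"
        by (simp add: \<delta>_def k_def)
      finally show "exp (8 * real (k\<^sup>2)) * (real (card X) * 2 ^ (2 * k choose 2) * \<delta> d) \<le> 1" .
    qed (use n k in \<open>auto simp: V_def X_def\<close>)
    have "K_free s V E"
      unfolding K_free_def
    proof clarify
      fix K assume K: "K \<subseteq> V" "s = card K" "clique K E"
      then have fin: "finite K"
        by (auto simp: V_def intro: finite_subset)
      have "[K]\<^bsup>2\<^esup> \<subseteq> E"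
        using K by (auto simp: clique_def nsets_2_eq)
      then have "card (E \<inter> [K]\<^bsup>2\<^esup>) = s choose 2"
        using K by (simp add: Int_absorb1)
      moreover have "K \<in> [V]\<^bsup>s\<^esup>"
        using K fin by (auto simp: nsets_def)
      ultimately show False
        using sparse[of s "s choose 2" K] by (simp add: X_def)
    qed
    moreover have "graph_vc_dim V E \<le> enat d"
      unfolding graph_vc_dim_def vc_dim_def
    proof (rule SUP_least)
      fix S assume S: "S \<in> {S. S \<subseteq> V \<and> finite S \<and> shatters (neighbourhood E ` V) S}"
      show "enat (card S) \<le> enat d"
      proof (rule ccontr)
        assume "\<not> enat (card S) \<le> enat d"
        \<comment> \<open>Shattering passes to subsets, so a set of more than d elements can be cut
          down to exactly k = d + 1.\<close>
        then obtain S' where S': "S' \<subseteq> S" "card S' = k"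
          using obtain_subset_with_card_n[of k S] by (auto simp: k_def)
        have "finite V" "S' \<subseteq> V" "5 \<le> k" "shatters (neighbourhood E ` V) S'"
          using S S' k shatters_subset by (auto simp: V_def)
        with S'(2) obtain W where "W \<in> [V]\<^bsup>(2 * k)\<^esup>" "k * (k - 2) \<le> card (E \<inter> [W]\<^bsup>2\<^esup>)"
          using shatters_imp_dense by metis
        then show False
          using sparse[of "2 * k" "k * (k - 2)" W] by (simp add: X_def)
      qed
    qed
    moreover have "\<not> (\<exists>I\<subseteq>V. indep I E \<and>
        32 / \<delta> d * real n powr (2 / (real s + 1)) * ln (real n) \<le> real (card I))"
    proof clarify
      fix I assume "I \<subseteq> V" "indep I E"
        "32 / \<delta> d * real n powr (2 / (real s + 1)) * ln (real n) \<le> real (card I)"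
      with large[of I] show False
        by (auto simp: V_def indep_def nsets_2_eq)
    qed
    ultimately show "\<exists>(V :: nat set) E. simple_graph V E \<and> card V = n \<and> K_free s V E \<and>
        graph_vc_dim V E \<le> enat d \<and>
        \<not> (\<exists>I\<subseteq>V. indep I E \<and>
          32 / \<delta> d * real n powr (2 / (real s + 1)) * ln (real n) \<le> real (card I))"
      using E by (intro exI[of _ V] exI[of _ E]) (simp add: simple_graph_def V_def)
  qed
qed

end
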